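(* Assume generators are homogeneous, i.e. $c_j=c$ for all $j\in\mathcal{G}$. If $|\mathcal{G}|>1$, then the two-stage symmetric Nash equilibrium of the standard market (without mitigation policy) uniquely exists and is given by \begin{align*} &\beta_j^d=\frac{b^dc}{|\mathcal{G}|}d+\frac{b^rc-\frac{|\mathcal{G}|-2}{|\mathcal{G}|-1}}{b^rc+\frac{|\mathcal{L}|+1}{|\mathcal{G}|-1}}\cdot\frac{|\mathcal{L}|+1}{|\mathcal{G}|(|\mathcal{G}|-1)}d^d,\quad\forall j\in\mathcal{G},\\ &\beta_j^r=\frac{b^rc}{|\mathcal{G}|}d-\frac{|\mathcal{G}|-2}{|\mathcal{G}|(|\mathcal{G}|-1)}d^r,\quad\forall j\in\mathcal{G},\\ &g_j^d=\frac{1}{|\mathcal{G}|}d^d,\qquad g_j^r=\frac{1}{|\mathcal{G}|}d^r,\quad\forall j\in\mathcal{G},\\ &d_l^d=\frac{b^d\,d_l}{b^d+b^r(|\mathcal{G}|-1)}+\frac{\frac{b^d}{1+b^rc(|\mathcal{G}|-1)}}{b^d+b^r(|\mathcal{G}|-1)}d^r-\frac{b^r}{b^d+b^r(|\mathcal{G}|-1)}d^d,\quad\forall l\in\mathcal{L},\\ &d_l^r=d_l-d_l^d,\quad\forall l\in\mathcal{L},\\ &\lambda^d=\frac{b^rc(|\mathcal{G}|-1)+2}{b^rc(|\mathcal{G}|-1)+1}\cdot\frac{c}{|\mathcal{G}|}d+\frac{\left(\frac{b^r}{b^d}-1\right)c+\frac{1}{b^d(|\mathcal{G}|-1)}}{b^rc(|\mathcal{G}|-1)+1}\cdot\frac{d^d}{|\mathcal{G}|},\\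 &\lambda^r=\lambda^d+\frac{\frac{1}{|\mathcal{G}|(|\mathcal{G}|-1)}\left(\frac{|\mathcal{G}|-2}{|\mathcal{G}|-1}-b^rc\right)d}{b^d\left(b^rc+\frac{|\mathcal{L}|+1}{|\mathcal{G}|-1}\right)+b^r\left(b^rc+\frac{1}{|\mathcal{G}|-1}\right)(|\mathcal{G}|+|\mathcal{L}|-1)}, \end{align*} where $d^d=\sum_{l\in\mathcal{L}}d_l^d$ and $d^r=\sum_{l\in\mathcal{L}}d_l^r$.
   Context: Market: $\mathcal{G}$ (generators) and $\mathcal{L}$ (loads) are finite nonempty sets. Generator $j$ has cost $\frac{c_j}{2}g_j^2$, $c_j>0$, for total dispatch $g_j=g_j^d+g_j^r$, where $g_j^d,g_j^r\in\mathbb{R}$ are its day-ahead and real-time dispatches. Load $l$ has fixed inelastic demand $d_l>0$ split as $d_l=d_l^d+d_l^r$ with $d_l^d,d_l^r\in\mathbb{R}$; $d:=\sum_l d_l$, $d^d:=\sum_l d_l^d$, $d^r:=\sum_l d_l^r=d-d^d$. Intercept-function bids: $b^d,b^r>0$ are fixed slopes. Generator $j$ bids $\beta_j^d\in\mathbb{R}$ day-ahead and $\beta_j^r\in\mathbb{R}$ in real time, meaning $g_j^d=b^d\lambda^d-\beta_j^d$ and $g_j^r=b^r\lambda^r-\beta_j^r$. Load $l$ bids $d_l^d$ day-ahead, and $d_l^r=d_l-d_l^d$ is then determined. Prices are set by clearing: $\sum_j(b^d\lambda^d-\beta_j^d)=d^d$ and $\sum_j(b^r\lambda^r-\beta_j^r)=d^r$.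 Profit of generator $j$: $\pi_j=\lambda^rg_j^r+\lambda^dg_j^d-\frac{c_j}{2}(g_j^d+g_j^r)^2$. Payment of load $l$: $\rho_l=\lambda^dd_l^d+\lambda^r(d_l-d_l^d)$. Nash equilibrium (price-anticipating participants, analyzed by backward induction). Real-time stage: given the day-ahead outcome, generators simultaneously choose $\beta_j^r$, each maximizing $\pi_j$ given the others' bids and anticipating its effect on the real-time clearing price $\lambda^r$; this defines the real-time subgame equilibrium. Day-ahead stage: all generators (choosing $\beta_j^d$) and all loads (choosing $d_l^d$) simultaneously maximize profit $\pi_j$, respectively minimize payment $\rho_l$, given the other participants' day-ahead bids and anticipating both the effect of their own bid on the day-ahead clearing price $\lambda^d$ and the resulting real-time subgame equilibrium. A two-stage Nash equilibrium is a profile of bids and clearing prices with no profitable deviation in this sense. It is symmetric if all generators make the same decisions: $\beta_j^d=\beta^d$ and $\beta_j^r=\beta^r$ for all $j\in\mathcal{G}$. *)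

theory Defs
  imports Complex_Main "HOL-Library.Cardinality"
begin

text \<open>
  A two-stage electricity market with intercept-function bids.  Generators and loads are the
  elements of finite types \<open>'g\<close> and \<open>'l\<close>.  Throughout, \<open>cost\<close> holds the generators' cost
  coefficients, \<open>d\<close> the loads' total demands, and \<open>bd\<close>, \<open>br\<close> are the bid slopes of the day-ahead
  and the real-time stage.  \<open>\<beta>d\<close>, \<open>\<beta>r\<close> are the generators' bids and \<open>dd\<close> the loads' bids.
\<close>

definition dispatch :: "real \<Rightarrow> real \<Rightarrow> ('g \<Rightarrow> real) \<Rightarrow> 'g \<Rightarrow> real" where
  "dispatch b p \<beta> j = b * p - \<beta> j"

definition clearing_price :: "real \<Rightarrow> ('g::finite \<Rightarrow> real) \<Rightarrow> real \<Rightarrow> real" where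
  "clearing_price b \<beta> D = (THE p. (\<Sum>j\<in>UNIV. dispatch b p \<beta> j) = D)"

lemma clearing_price_iff:
  fixes \<beta> :: "'g::finite \<Rightarrow> real"
  assumes "b > 0"
  shows "(\<Sum>j\<in>UNIV. dispatch b p \<beta> j) = D \<longleftrightarrow> p = clearing_price b \<beta> D"
proof -
  have sol: "(\<Sum>j\<in>UNIV. dispatch b q \<beta> j) = D \<longleftrightarrow> q = (D + sum \<beta> UNIV) / (real CARD('g) * b)" for q
    using assms by (auto simp: dispatch_def sum_subtractf field_simps)
  have "clearing_price b \<beta> D = (D + sum \<beta> UNIV) / (real CARD('g) * b)"
    unfolding clearing_price_def sol by simp
  then show ?thesis
    by (simp add: sol)
qed

definition da_price :: "real \<Rightarrow> ('g::finite \<Rightarrow> real) \<Rightarrow> ('l::finite \<Rightarrow> real) \<Rightarrow> real" where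
  "da_price bd \<beta>d dd = clearing_price bd \<beta>d (\<Sum>l\<in>UNIV. dd l)"

definition rt_price ::
    "('l::finite \<Rightarrow> real) \<Rightarrow> real \<Rightarrow> ('l \<Rightarrow> real) \<Rightarrow> ('g::finite \<Rightarrow> real) \<Rightarrow> real" where
  "rt_price d br dd \<beta>r = clearing_price br \<beta>r (\<Sum>l\<in>UNIV. d l - dd l)"

definition profit ::
    "('g::finite \<Rightarrow> real) \<Rightarrow> ('l::finite \<Rightarrow> real) \<Rightarrow> real \<Rightarrow> real
      \<Rightarrow> ('g \<Rightarrow> real) \<Rightarrow> ('l \<Rightarrow> real) \<Rightarrow> ('g \<Rightarrow> real) \<Rightarrow> 'g \<Rightarrow> real" where
  "profit cost d bd br \<beta>d dd \<beta>r j =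
    (let pd = da_price bd \<beta>d dd; pr = rt_price d br dd \<beta>r;
         gd = dispatch bd pd \<beta>d j; gr = dispatch br pr \<beta>r j
     in pr * gr + pd * gd - cost j / 2 * (gd + gr)\<^sup>2)"

definition payment ::
    "('l::finite \<Rightarrow> real) \<Rightarrow> real \<Rightarrow> real
      \<Rightarrow> ('g::finite \<Rightarrow> real) \<Rightarrow> ('l \<Rightarrow> real) \<Rightarrow> ('g \<Rightarrow> real) \<Rightarrow> 'l \<Rightarrow> real" where
  "payment d bd br \<beta>d dd \<beta>r l =
    da_price bd \<beta>d dd * dd l + rt_price d br dd \<beta>r * (d l - dd l)"

text \<open>
  Nash equilibrium of the real-time subgame that follows the day-ahead bids \<open>\<beta>d\<close>, \<open>dd\<close>; these
  determine the whole day-ahead outcome.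
\<close>

definition rt_equilibrium ::
    "('g::finite \<Rightarrow> real) \<Rightarrow> ('l::finite \<Rightarrow> real) \<Rightarrow> real \<Rightarrow> real
      \<Rightarrow> ('g \<Rightarrow> real) \<Rightarrow> ('l \<Rightarrow> real) \<Rightarrow> ('g \<Rightarrow> real) \<Rightarrow> bool" where
  "rt_equilibrium cost d bd br \<beta>d dd \<beta>r \<longleftrightarrow>
    (\<forall>j x. profit cost d bd br \<beta>d dd (\<beta>r(j := x)) j \<le> profit cost d bd br \<beta>d dd \<beta>r j)"

record ('g, 'l) outcome =
  bid_da :: "'g \<Rightarrow> real"
  bid_rt :: "'g \<Rightarrow> real"
  demand_da :: "'l \<Rightarrow> real"
  price_da :: real
  price_rt :: real

text \<open>
  Backward induction: \<open>\<sigma>\<close> assigns to every profile of day-ahead bids an equilibrium of the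
  ensuing real-time subgame.  A participant deviating in the day-ahead stage anticipates that
  the real-time bids react to the deviation through \<open>\<sigma>\<close>.
\<close>

definition two_stage_equilibrium ::
    "('g::finite \<Rightarrow> real) \<Rightarrow> ('l::finite \<Rightarrow> real) \<Rightarrow> real \<Rightarrow> real \<Rightarrow> ('g, 'l) outcome \<Rightarrow> bool" where
  "two_stage_equilibrium cost d bd br e \<longleftrightarrow>
    (let \<beta>d = bid_da e; \<beta>r = bid_rt e; dd = demand_da e in
      price_da e = da_price bd \<beta>d dd \<and>
      price_rt e = rt_price d br dd \<beta>r \<and>
      (\<exists>\<sigma>. (\<forall>\<beta>d' dd'. rt_equilibrium cost d bd br \<beta>d' dd' (\<sigma> \<beta>d' dd')) \<and>
           \<beta>r = \<sigma> \<beta>d dd \<and>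
           (\<forall>j x. profit cost d bd br (\<beta>d(j := x)) dd (\<sigma> (\<beta>d(j := x)) dd) j
                  \<le> profit cost d bd br \<beta>d dd \<beta>r j) \<and>
           (\<forall>l x. payment d bd br \<beta>d dd \<beta>r l
                  \<le> payment d bd br \<beta>d (dd(l := x)) (\<sigma> \<beta>d (dd(l := x))) l)))"

definition symmetric_equilibrium ::
    "('g::finite \<Rightarrow> real) \<Rightarrow> ('l::finite \<Rightarrow> real) \<Rightarrow> real \<Rightarrow> real \<Rightarrow> ('g, 'l) outcome \<Rightarrow> bool" where
  "symmetric_equilibrium cost d bd br e \<longleftrightarrow>
    two_stage_equilibrium cost d bd br e \<and>
    (\<exists>\<beta>. \<forall>j. bid_da e j = \<beta>) \<and> (\<exists>\<beta>. \<forall>j. bid_rt e j = \<beta>)"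

definition gen_da :: "real \<Rightarrow> ('g, 'l) outcome \<Rightarrow> 'g \<Rightarrow> real" where
  "gen_da bd e j = dispatch bd (price_da e) (bid_da e) j"

definition gen_rt :: "real \<Rightarrow> ('g, 'l) outcome \<Rightarrow> 'g \<Rightarrow> real" where
  "gen_rt br e j = dispatch br (price_rt e) (bid_rt e) j"

definition demand_rt :: "('l \<Rightarrow> real) \<Rightarrow> ('g, 'l) outcome \<Rightarrow> 'l \<Rightarrow> real" where
  "demand_rt d e l = d l - demand_da e l"

end

theory Submission
  imports Defs
begin

text \<open>
  Every payoff is a strictly concave quadratic in the participant's own bid, so an equilibrium is
  the same as a system of linear first-order conditions.  In the real-time stage this system has
  exactly one solution, whose price depends on the day-ahead bids only through the total day-ahead
  demand; hence the continuation strategy \<open>\<sigma>\<close> is forced, and a generator's day-ahead deviation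
  moves its real-time dispatch but not the real-time price.  For equal day-ahead bids the
  day-ahead conditions determine both prices from the total demands, and summing the loads'
  conditions fixes the total day-ahead demand.
\<close>

section \<open>One-variable quadratics and clearing prices\<close>

lemma linear_le_quadratic_iff:
  fixes q s :: real
  assumes "q > 0"
  shows "(\<forall>t. s * t \<le> q * t\<^sup>2) \<longleftrightarrow> s = 0"
proof
  assume "\<forall>t. s * t \<le> q * t\<^sup>2"
  \<comment> \<open>The test point \<open>s / (2 * q)\<close> maximises
    \<open>s * t - q * t\<^sup>2\<close>; there the linear term is twice the quadratic one, which
    forces \<open>s * s \<le> 0\<close>.\<close>
  then have "s * (s / (2 * q)) \<le> q * (s / (2 * q))\<^sup>2" by blast
  also have "\<dots> = s * (s / (2 * q)) / 2"
    using assms by (simp add: field_simps power2_eq_square)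
  finally have "s * s / (2 * q) \<le> 0" by simp
  then have "s * s \<le> 0" using assms by (simp add: field_simps)
  then show "s = 0" using not_square_less_zero[of s] by (metis antisym_conv2 mult_eq_0_iff)
qed (use assms in simp)

text \<open>Replaces calculus: once a payoff is expanded around the current bid \<open>x0\<close>,
  with current value \<open>v\<close>, the absence of a profitable deviation amounts to a vanishing
  slope \<open>s\<close>.\<close>

lemma quadratic_max_iff:
  fixes f :: "real \<Rightarrow> real"
  assumes "q > 0" and "\<And>x. f x = v + s * (x - x0) - q * (x - x0)\<^sup>2"
  shows "(\<forall>x. f x \<le> v) \<longleftrightarrow> s = 0"
proof -
  have "(\<forall>x. f x \<le> v) \<longleftrightarrow> (\<forall>x. s * (x - x0) \<le> q * (x - x0)\<^sup>2)"
    by (simp add: assms(2))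
  also have "\<dots> \<longleftrightarrow> (\<forall>t. s * t \<le> q * t\<^sup>2)"
    by (metis add_diff_cancel_right')
  finally show ?thesis using linear_le_quadratic_iff[OF assms(1)] by simp
qed

lemma sum_fun_upd:
  fixes f :: "'a::finite \<Rightarrow> real"
  shows "sum (f(a := x)) UNIV = sum f UNIV + (x - f a)"
proof -
  have "sum (f(a := x)) UNIV = x + sum f (UNIV - {a})"
    by (subst sum.remove[of _ a]) (auto intro!: sum.cong)
  moreover have "sum f UNIV = f a + sum f (UNIV - {a})"
    by (rule sum.remove) auto
  ultimately show ?thesis by simp
qed

lemma clearing_price_eq:
  fixes \<beta> :: "'g::finite \<Rightarrow> real"
  assumes "b > 0"
  shows "clearing_price b \<beta> D = (D + sum \<beta> UNIV) / (real CARD('g) * b)"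
proof -
  have "(\<Sum>j\<in>UNIV. dispatch b ((D + sum \<beta> UNIV) / (real CARD('g) * b)) \<beta> j) = D"
    using assms by (simp add: dispatch_def sum_subtractf)
  then show ?thesis using clearing_price_iff[OF assms] by metis
qed

lemma sum_dispatch_clearing_price:
  fixes \<beta> :: "'g::finite \<Rightarrow> real"
  assumes "b > 0"
  shows "(\<Sum>j\<in>UNIV. dispatch b (clearing_price b \<beta> D) \<beta> j) = D"
  using clearing_price_iff[OF assms] by blast

lemma clearing_price_fun_upd:
  fixes \<beta> :: "'g::finite \<Rightarrow> real"
  assumes "b > 0"
  shows "clearing_price b (\<beta>(j := x)) D = clearing_price b \<beta> D + (x - \<beta> j) / (real CARD('g) * b)"
  unfolding clearing_price_eq[OF assms] sum_fun_upd by (simp add: add_divide_distrib)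

section \<open>The market with identical generators\<close>

locale homogeneous_market =
  fixes cost :: "'g::finite \<Rightarrow> real" and d :: "'l::finite \<Rightarrow> real" and c bd br :: real
  assumes cost: "cost = (\<lambda>_. c)" and c_pos: "c > 0" and bd_pos: "bd > 0" and br_pos: "br > 0"
    and card_gt_1: "CARD('g) > 1"
begin

definition n :: real where "n = real CARD('g)"
definition m :: real where "m = real CARD('l)"
text \<open>The number of rivals of a generator; with bid slope \<open>b\<close> its residual demand
  has slope \<open>b * k\<close>.\<close>

definition k :: real where "k = n - 1"
text \<open>At a fixed real-time price, one more unit dispatched day-ahead lowers a generator's
  equilibrium real-time dispatch by \<open>A / (1 + A)\<close>; hence the recurring denominator
  \<open>1 + A\<close>.\<close>

definition A :: real where "A = br * c * k"
definition D :: real where "D = (\<Sum>l\<in>UNIV. d l)"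

lemma k_pos: "k > 0" and n_pos: "n > 0" and m_pos: "m > 0" and n_eq: "n = k + 1"
  using card_gt_1 by (simp_all add: k_def n_def m_def)

lemma A_pos: "A > 0"
  using c_pos br_pos k_pos by (simp add: A_def)

text \<open>A bid raised by \<open>t\<close> lifts the clearing price by \<open>t / (n * b)\<close>,
  so the bidder's own dispatch moves by \<open>t / n - t\<close>.\<close>

lemma dispatch_clearing_fun_upd:
  fixes \<beta> :: "'g \<Rightarrow> real"
  assumes "b > 0"
  shows "dispatch b (clearing_price b (\<beta>(j := x)) E) (\<beta>(j := x)) j
    = dispatch b (clearing_price b \<beta> E) \<beta> j - k / n * (x - \<beta> j)"
  using assms n_pos
  by (simp add: clearing_price_fun_upd dispatch_def k_def n_def[symmetric] field_simps)

lemma rt_demand: "(\<Sum>l\<in>UNIV. d l - dd l) = D - sum dd UNIV"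
  by (simp add: sum_subtractf D_def)

definition da_dispatch :: "('g \<Rightarrow> real) \<Rightarrow> ('l \<Rightarrow> real) \<Rightarrow> 'g \<Rightarrow> real" where
  "da_dispatch \<beta>d dd j = dispatch bd (da_price bd \<beta>d dd) \<beta>d j"

lemma sum_da_dispatch: "(\<Sum>j\<in>UNIV. da_dispatch \<beta>d dd j) = sum dd UNIV"
  using bd_pos by (simp add: da_dispatch_def da_price_def sum_dispatch_clearing_price)

section \<open>The real-time subgame\<close>

text \<open>The rivals jointly supply with slope \<open>br * k\<close>, so optimality equates a
  generator's real-time dispatch with that slope times the markup of the price over its marginal
  cost.\<close>

lemma rt_equilibrium_foc:
  "rt_equilibrium cost d bd br \<beta>d dd \<beta>r \<longleftrightarrow>
    (\<forall>j. dispatch br (rt_price d br dd \<beta>r) \<beta>r j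
      = br * k * (rt_price d br dd \<beta>r
          - c * (da_dispatch \<beta>d dd j + dispatch br (rt_price d br dd \<beta>r) \<beta>r j)))"
proof -
  have "(\<forall>x. profit cost d bd br \<beta>d dd (\<beta>r(j := x)) j \<le> profit cost d bd br \<beta>d dd \<beta>r j) \<longleftrightarrow>
    dispatch br (rt_price d br dd \<beta>r) \<beta>r j
      = br * k * (rt_price d br dd \<beta>r
          - c * (da_dispatch \<beta>d dd j + dispatch br (rt_price d br dd \<beta>r) \<beta>r j))" for j
  proof -
    define p where "p = rt_price d br dd \<beta>r"
    define gr where "gr = dispatch br p \<beta>r j"
    define gd where "gd = da_dispatch \<beta>d dd j"
    \<comment> \<open>\<open>s\<close> is the derivative of the profit in the generator's own bid,
      and \<open>q\<close> is minus half the second derivative.\<close>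
    define s where "s = gr / (n * br) - k / n * p + k / n * c * (gd + gr)"
    define q where "q = k / (n\<^sup>2 * br) + c / 2 * (k / n)\<^sup>2"
    have q: "q > 0"
      using k_pos n_pos br_pos c_pos by (simp add: q_def add_pos_pos)
    have "profit cost d bd br \<beta>d dd (\<beta>r(j := x)) j
        = profit cost d bd br \<beta>d dd \<beta>r j + s * (x - \<beta>r j) - q * (x - \<beta>r j)\<^sup>2" for x
    proof -
      define t where "t = x - \<beta>r j"
      have p': "rt_price d br dd (\<beta>r(j := x)) = p + t / (n * br)"
        using br_pos by (simp add: rt_price_def p_def clearing_price_fun_upd n_def t_def)
      have g': "dispatch br (p + t / (n * br)) (\<beta>r(j := x)) j = gr - k / n * t"
        unfolding p'[symmetric] unfolding rt_price_def p_def gr_def t_def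
        by (rule dispatch_clearing_fun_upd[OF br_pos])
      have "(p + t / (n * br)) * (gr - k / n * t) - c / 2 * (gd + (gr - k / n * t))\<^sup>2
        = p * gr - c / 2 * (gd + gr)\<^sup>2 + s * t - q * t\<^sup>2"
        unfolding s_def q_def using n_pos br_pos
        by (simp add: field_simps power2_eq_square)
      then show ?thesis
        unfolding profit_def Let_def p' g' t_def[symmetric]
        unfolding p_def[symmetric] gr_def[symmetric] gd_def[unfolded da_dispatch_def, symmetric] cost
        by (simp add: algebra_simps)
    qed
    from quadratic_max_iff[OF q this]
    have "(\<forall>x. profit cost d bd br \<beta>d dd (\<beta>r(j := x)) j \<le> profit cost d bd br \<beta>d dd \<beta>r j)
      \<longleftrightarrow> s = 0" .
    also have "s = (gr - br * k * (p - c * (gd + gr))) / (n * br)"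
      unfolding s_def using n_pos br_pos by (simp add: field_simps)
    also have "\<dots> = 0 \<longleftrightarrow> gr = br * k * (p - c * (gd + gr))"
      using n_pos br_pos by simp
    finally show ?thesis
      unfolding gr_def p_def gd_def .
  qed
  then show ?thesis by (simp add: rt_equilibrium_def)
qed

text \<open>Summing the first-order conditions over all generators leaves only total dispatches and
  yields this price: the marginal cost at the equal share \<open>D / n\<close> plus an average
  markup.\<close>

definition rt_response_price :: "real \<Rightarrow> real" where
  "rt_response_price Dd = c * D / n + (D - Dd) / (n * br * k)"

text \<open>The first-order condition solved for a generator's real-time dispatch, at the price just
  defined.\<close>

definition rt_response_dispatch :: "('g \<Rightarrow> real) \<Rightarrow> ('l \<Rightarrow> real) \<Rightarrow> 'g \<Rightarrow> real" where
  "rt_response_dispatch \<beta>d dd j =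
    br * k * (rt_response_price (sum dd UNIV) - c * da_dispatch \<beta>d dd j) / (1 + A)"

definition rt_response :: "('g \<Rightarrow> real) \<Rightarrow> ('l \<Rightarrow> real) \<Rightarrow> 'g \<Rightarrow> real" where
  "rt_response \<beta>d dd j =
    br * rt_response_price (sum dd UNIV) - rt_response_dispatch \<beta>d dd j"

lemma n_rt_response_price: "br * k * (n * rt_response_price Dd - c * D) = D - Dd"
  using n_pos br_pos k_pos by (simp add: rt_response_price_def field_simps)

text \<open>Closes the loop: the dispatches solved at the candidate price add up to the real-time
  demand, so that price does clear the market.\<close>

lemma sum_rt_response_dispatch:
  "(\<Sum>j\<in>UNIV. rt_response_dispatch \<beta>d dd j) = D - sum dd UNIV"
proof -
  let ?p = "rt_response_price (sum dd UNIV)"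
  have "(\<Sum>j\<in>UNIV. rt_response_dispatch \<beta>d dd j)
      = br * k * (n * ?p - c * sum dd UNIV) / (1 + A)"
    by (simp add: rt_response_dispatch_def sum_divide_distrib[symmetric] sum_distrib_left[symmetric]
        sum_subtractf sum_da_dispatch n_def)
  \<comment> \<open>Write \<open>n * ?p - c * sum dd UNIV\<close> as \<open>n * ?p - c * D\<close>
    plus \<open>c * (D - sum dd UNIV)\<close>; the second part contributes the factor
    \<open>A\<close>.\<close>
  also have "br * k * (n * ?p - c * sum dd UNIV) = (D - sum dd UNIV) * (1 + A)"
    using n_rt_response_price[of "sum dd UNIV"] by (simp add: A_def algebra_simps)
  finally show ?thesis using A_pos by simp
qed

lemma rt_price_rt_response:
  "rt_price d br dd (rt_response \<beta>d dd) = rt_response_price (sum dd UNIV)"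
proof -
  have "(\<Sum>j\<in>UNIV. dispatch br (rt_response_price (sum dd UNIV)) (rt_response \<beta>d dd) j)
      = D - sum dd UNIV"
    by (simp add: dispatch_def rt_response_def sum_rt_response_dispatch)
  then show ?thesis
    unfolding clearing_price_iff[OF br_pos] by (simp add: rt_price_def rt_demand)
qed

lemma dispatch_rt_response:
  "dispatch br (rt_response_price (sum dd UNIV)) (rt_response \<beta>d dd) j = rt_response_dispatch \<beta>d dd j"
  by (simp add: dispatch_def rt_response_def)

text \<open>The summed conditions determine the price, and at that price each condition is linear in
  one dispatch with coefficient \<open>1 + A > 0\<close>; the subgame equilibrium therefore exists
  and is unique.\<close>

lemma rt_equilibrium_iff:
  "rt_equilibrium cost d bd br \<beta>d dd \<beta>r \<longleftrightarrow> \<beta>r = rt_response \<beta>d dd"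
proof
  assume eq: "\<beta>r = rt_response \<beta>d dd"
  have "rt_response_dispatch \<beta>d dd j = br * k * (rt_response_price (sum dd UNIV)
      - c * (da_dispatch \<beta>d dd j + rt_response_dispatch \<beta>d dd j))" for j
  proof -
    have "rt_response_dispatch \<beta>d dd j * (1 + A)
        = br * k * (rt_response_price (sum dd UNIV) - c * da_dispatch \<beta>d dd j)"
      using A_pos by (simp add: rt_response_dispatch_def)
    then show ?thesis by (simp add: A_def algebra_simps)
  qed
  then show "rt_equilibrium cost d bd br \<beta>d dd \<beta>r"
    unfolding eq rt_equilibrium_foc rt_price_rt_response dispatch_rt_response by blast
next
  assume "rt_equilibrium cost d bd br \<beta>d dd \<beta>r"
  define p where "p = rt_price d br dd \<beta>r"
  define g where "g = dispatch br p \<beta>r"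
  have foc: "g j = br * k * (p - c * (da_dispatch \<beta>d dd j + g j))" for j
    using \<open>rt_equilibrium cost d bd br \<beta>d dd \<beta>r\<close>[unfolded rt_equilibrium_foc]
    by (simp add: p_def g_def)
  have sum_g: "sum g UNIV = D - sum dd UNIV"
    using sum_dispatch_clearing_price[OF br_pos]
    by (simp add: g_def p_def rt_price_def rt_demand)
  have "sum g UNIV = (\<Sum>j\<in>UNIV. br * k * (p - c * (da_dispatch \<beta>d dd j + g j)))"
    using foc by (intro sum.cong) auto
  also have "\<dots> = br * k * (n * p - c * (sum dd UNIV + sum g UNIV))"
    by (simp add: sum_distrib_left[symmetric] sum_subtractf sum.distrib sum_da_dispatch n_def)
  finally have "br * k * (n * p - c * D) = D - sum dd UNIV"
    by (simp add: sum_g)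
  then have "br * k * (n * p - c * D) = br * k * (n * rt_response_price (sum dd UNIV) - c * D)"
    by (simp add: n_rt_response_price)
  then have p: "p = rt_response_price (sum dd UNIV)"
    using br_pos k_pos n_pos by simp
  have "g j * (1 + A) = br * k * (p - c * da_dispatch \<beta>d dd j)" for j
    using foc[of j] by (simp add: A_def algebra_simps)
  then have "g j = rt_response_dispatch \<beta>d dd j" for j
    using A_pos by (simp add: rt_response_dispatch_def p[symmetric] field_simps)
  then show "\<beta>r = rt_response \<beta>d dd"
    by (auto simp: fun_eq_iff rt_response_def p[symmetric] g_def dispatch_def algebra_simps)
qed

section \<open>First-order conditions of the day-ahead stage\<close>

text \<open>Uniqueness in every subgame leaves \<open>rt_response\<close> as the only admissible
  \<open>\<sigma>\<close>, which eliminates the existential quantifier.\<close>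

lemma two_stage_equilibrium_iff:
  "two_stage_equilibrium cost d bd br e \<longleftrightarrow>
    price_da e = da_price bd (bid_da e) (demand_da e) \<and>
    price_rt e = rt_response_price (sum (demand_da e) UNIV) \<and>
    bid_rt e = rt_response (bid_da e) (demand_da e) \<and>
    (\<forall>j x. profit cost d bd br ((bid_da e)(j := x)) (demand_da e)
              (rt_response ((bid_da e)(j := x)) (demand_da e)) j
           \<le> profit cost d bd br (bid_da e) (demand_da e)
              (rt_response (bid_da e) (demand_da e)) j) \<and>
    (\<forall>l x. payment d bd br (bid_da e) (demand_da e) (rt_response (bid_da e) (demand_da e)) l
           \<le> payment d bd br (bid_da e) ((demand_da e)(l := x))
              (rt_response (bid_da e) ((demand_da e)(l := x))) l)"
proof -
  have "(\<forall>\<beta>d dd. rt_equilibrium cost d bd br \<beta>d dd (\<sigma> \<beta>d dd)) \<longleftrightarrow> \<sigma> = rt_response" for \<sigma>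
    unfolding rt_equilibrium_iff by (auto simp: fun_eq_iff)
  then show ?thesis
    unfolding two_stage_equilibrium_def Let_def
    by (auto simp: rt_price_rt_response)
qed

text \<open>The deviation leaves the total day-ahead demand, and with it the real-time price,
  unchanged; profit varies through the day-ahead price and both dispatches of the deviator. The
  condition is \<open>n\<close> times the slope of the profit.\<close>

lemma generator_da_foc:
  "(\<forall>x. profit cost d bd br (\<beta>d(j := x)) dd (rt_response (\<beta>d(j := x)) dd) j
        \<le> profit cost d bd br \<beta>d dd (rt_response \<beta>d dd) j) \<longleftrightarrow>
    rt_response_price (sum dd UNIV) * A * k / (1 + A) + da_dispatch \<beta>d dd j / bd
      - da_price bd \<beta>d dd * k
      + c * (da_dispatch \<beta>d dd j + rt_response_dispatch \<beta>d dd j) * k / (1 + A) = 0"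
proof -
  define pr where "pr = rt_response_price (sum dd UNIV)"
  define p where "p = da_price bd \<beta>d dd"
  define gd where "gd = da_dispatch \<beta>d dd j"
  define gr where "gr = rt_response_dispatch \<beta>d dd j"
  \<comment> \<open>\<open>h\<close> is the loss of total dispatch per unit of day-ahead bid: the
    day-ahead dispatch falls by \<open>k / n\<close>, of which \<open>A * h\<close> is regained in
    real time.\<close>
  define h where "h = k / (n * (1 + A))"
  define s where "s = pr * (A * h) + gd / (n * bd) - k / n * p + h * c * (gd + gr)"
  define q where "q = k / (n\<^sup>2 * bd) + c / 2 * h\<^sup>2"
  have q: "q > 0"
    using k_pos n_pos bd_pos c_pos by (simp add: q_def add_pos_nonneg)
  have kn: "k / n = h + A * h"
    using n_pos A_pos by (simp add: h_def divide_simps) (simp add: algebra_simps)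
  have "profit cost d bd br (\<beta>d(j := x)) dd (rt_response (\<beta>d(j := x)) dd) j
      = profit cost d bd br \<beta>d dd (rt_response \<beta>d dd) j + s * (x - \<beta>d j) - q * (x - \<beta>d j)\<^sup>2" for x
  proof -
    define t where "t = x - \<beta>d j"
    have p': "da_price bd (\<beta>d(j := x)) dd = p + t / (n * bd)"
      using bd_pos by (simp add: da_price_def p_def clearing_price_fun_upd n_def t_def)
    have gd': "da_dispatch (\<beta>d(j := x)) dd j = gd - k / n * t"
      using dispatch_clearing_fun_upd[OF bd_pos, of \<beta>d j x]
      by (simp add: da_dispatch_def da_price_def gd_def t_def)
    have gr': "rt_response_dispatch (\<beta>d(j := x)) dd j = gr + A * h * t"
      using n_pos A_pos
      by (simp add: rt_response_dispatch_def gd' gr_def gd_def[symmetric] A_def h_def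
          add_divide_distrib diff_divide_distrib algebra_simps)
    have sq: "(p + t / (n * bd)) * (gd - k / n * t)
        = p * gd + (gd / (n * bd) - k / n * p) * t - k / (n\<^sup>2 * bd) * t\<^sup>2"
      using n_pos bd_pos by (simp add: field_simps power2_eq_square)
    have tot: "gd - k / n * t + (gr + A * h * t) = gd + gr - h * t"
      unfolding kn by (simp add: algebra_simps)
    have "pr * (gr + A * h * t) + (p + t / (n * bd)) * (gd - k / n * t)
          - c / 2 * (gd - k / n * t + (gr + A * h * t))\<^sup>2
        = pr * gr + p * gd - c / 2 * (gd + gr)\<^sup>2 + s * t - q * t\<^sup>2"
      unfolding tot sq s_def q_def by (simp add: algebra_simps power2_eq_square)
    then show ?thesis
      unfolding profit_def Let_def rt_price_rt_response dispatch_rt_response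
        da_dispatch_def[symmetric] t_def[symmetric] cost
      unfolding p' gd' gr'
      unfolding p_def[symmetric] gd_def[symmetric] gr_def[symmetric] pr_def[symmetric] .
  qed
  from quadratic_max_iff[OF q this]
  have "(\<forall>x. profit cost d bd br (\<beta>d(j := x)) dd (rt_response (\<beta>d(j := x)) dd) j
        \<le> profit cost d bd br \<beta>d dd (rt_response \<beta>d dd) j) \<longleftrightarrow> s = 0" .
  also have "s = (pr * A * k / (1 + A) + gd / bd - p * k + c * (gd + gr) * k / (1 + A)) / n"
    unfolding s_def h_def by (simp add: add_divide_distrib diff_divide_distrib mult_ac)
  also have "\<dots> = 0 \<longleftrightarrow>
      pr * A * k / (1 + A) + gd / bd - p * k + c * (gd + gr) * k / (1 + A) = 0"
    using n_pos by simp
  finally show ?thesis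
    unfolding gr_def gd_def p_def pr_def .
qed

text \<open>Marginal expenditure must agree across the stages. A unit moved to the day-ahead stage
  raises that price by \<open>1 / (n * bd)\<close> and lowers the real-time price by
  \<open>1 / (n * br * k)\<close>, the latter including the generators' rebidding.\<close>

lemma load_da_foc:
  "(\<forall>x. payment d bd br \<beta>d dd (rt_response \<beta>d dd) l
        \<le> payment d bd br \<beta>d (dd(l := x)) (rt_response \<beta>d (dd(l := x))) l) \<longleftrightarrow>
    da_price bd \<beta>d dd + dd l / (n * bd)
      = rt_response_price (sum dd UNIV) + (d l - dd l) / (n * br * k)"
proof -
  define pr where "pr = rt_response_price (sum dd UNIV)"
  define p where "p = da_price bd \<beta>d dd"
  define u where "u = 1 / (n * bd)"
  define v where "v = 1 / (n * br * k)"
  define s where "s = pr + (d l - dd l) * v - (p + dd l * u)"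
  have q: "u + v > 0"
    using n_pos bd_pos br_pos k_pos by (simp add: u_def v_def add_pos_pos)
  \<comment> \<open>The sign change turns minimisation of the payment into the maximisation treated
    by \<open>quadratic_max_iff\<close>.\<close>
  have "- payment d bd br \<beta>d (dd(l := x)) (rt_response \<beta>d (dd(l := x))) l
      = - payment d bd br \<beta>d dd (rt_response \<beta>d dd) l + s * (x - dd l) - (u + v) * (x - dd l)\<^sup>2" for x
  proof -
    define t where "t = x - dd l"
    have p': "da_price bd \<beta>d (dd(l := x)) = p + t * u"
      unfolding da_price_def p_def clearing_price_eq[OF bd_pos] sum_fun_upd
      by (simp add: add_divide_distrib diff_divide_distrib u_def n_def t_def)
    have pr': "rt_response_price (sum (dd(l := x)) UNIV) = pr - t * v"
      unfolding rt_response_price_def pr_def sum_fun_upd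
      by (simp add: add_divide_distrib diff_divide_distrib v_def t_def)
    have x: "x = dd l + t" by (simp add: t_def)
    show ?thesis
      unfolding payment_def rt_price_rt_response p' pr'
      unfolding p_def[symmetric] pr_def[symmetric] t_def[symmetric] s_def
      by (simp add: x algebra_simps power2_eq_square)
  qed
  from quadratic_max_iff[OF q this]
  have "(\<forall>x. payment d bd br \<beta>d dd (rt_response \<beta>d dd) l
        \<le> payment d bd br \<beta>d (dd(l := x)) (rt_response \<beta>d (dd(l := x))) l) \<longleftrightarrow> s = 0"
    by simp
  then show ?thesis
    by (auto simp: s_def u_def v_def p_def pr_def)
qed

text \<open>The day-ahead price at which the generators' first-order condition holds when they all
  dispatch \<open>Dd / n\<close>.\<close>

definition da_symmetric_price :: "real \<Rightarrow> real" where
  "da_symmetric_price Dd = c * D / n + c * (D - Dd) / (n * (1 + A)) + Dd / (n * bd * k)"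

text \<open>With equal shares the marginal cost is \<open>c * D / n\<close>, and the condition is
  linear in \<open>p\<close> with nonzero coefficient \<open>- k\<close>.\<close>

lemma symmetric_generator_foc:
  assumes "gd = Dd / n" and "gr = (D - Dd) / n"
  shows "rt_response_price Dd * A * k / (1 + A) + gd / bd - p * k + c * (gd + gr) * k / (1 + A) = 0
    \<longleftrightarrow> p = da_symmetric_price Dd"
proof -
  have c: "c * (gd + gr) = c * D / n"
    unfolding assms by (simp add: add_divide_distrib[symmetric])
  have "rt_response_price Dd * A = A * (c * D / n) + c * (D - Dd) / n"
    using br_pos k_pos n_pos by (simp add: rt_response_price_def A_def field_simps)
  then have r: "rt_response_price Dd * A + c * D / n = (1 + A) * (c * D / n) + c * (D - Dd) / n"
    unfolding distrib_right by simp
  have "rt_response_price Dd * A * k / (1 + A) + gd / bd - p * k + c * (gd + gr) * k / (1 + A)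
      = k * ((rt_response_price Dd * A + c * D / n) / (1 + A) + Dd / (n * bd * k) - p)"
    unfolding c assms using k_pos by (simp add: add_divide_distrib diff_divide_distrib algebra_simps)
  also have "(rt_response_price Dd * A + c * D / n) / (1 + A)
      = c * D / n + c * (D - Dd) / (n * (1 + A))"
    unfolding r using A_pos by (simp add: add_divide_distrib)
  finally show ?thesis
    using k_pos by (auto simp: da_symmetric_price_def)
qed

lemma load_foc_solved:
  "da_symmetric_price Dd + x / (n * bd) = rt_response_price Dd + (y - x) / (n * br * k) \<longleftrightarrow>
    x = bd * y / (bd + br * k) + bd / (1 + A) / (bd + br * k) * (D - Dd) - br / (bd + br * k) * Dd"
proof -
  \<comment> \<open>Both prices contain \<open>c * D / n\<close>, which cancels. In terms of
    \<open>E\<close> the remaining \<open>D - Dd\<close> terms combine to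
    \<open>- E / (n * br * k)\<close>, again by \<open>A = br * c * k\<close>.\<close>
  define E where "E = (D - Dd) / (1 + A)"
  have E: "D - Dd = E * (1 + A)" using A_pos by (simp add: E_def)
  have w: "bd + br * k > 0" using bd_pos br_pos k_pos by (simp add: add_pos_pos)
  have "da_symmetric_price Dd + x / (n * bd) - (rt_response_price Dd + (y - x) / (n * br * k))
      = c * E / n + Dd / (n * bd * k) + x / (n * bd) - E * (1 + A) / (n * br * k)
        - (y - x) / (n * br * k)"
    unfolding da_symmetric_price_def rt_response_price_def E using A_pos by simp
  also have "\<dots> = (x * (bd + br * k) - (bd * y + bd * E - br * Dd)) / (n * bd * br * k)"
    using n_pos bd_pos br_pos k_pos by (simp add: A_def field_simps)
  finally have "da_symmetric_price Dd + x / (n * bd) = rt_response_price Dd + (y - x) / (n * br * k)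
      \<longleftrightarrow> x * (bd + br * k) = bd * y + bd * E - br * Dd"
    using n_pos bd_pos br_pos k_pos by auto
  also have "\<dots> \<longleftrightarrow> x = (bd * y + bd * E - br * Dd) / (bd + br * k)"
    using w by (simp add: field_simps)
  also have "(bd * y + bd * E - br * Dd) / (bd + br * k)
    = bd * y / (bd + br * k) + bd / (1 + A) / (bd + br * k) * (D - Dd) - br / (bd + br * k) * Dd"
  proof -
    have "bd / (1 + A) / (bd + br * k) * (D - Dd) = bd * E / (bd + br * k)"
      by (simp add: E_def)
    then show ?thesis
      by (simp only: add_divide_distrib diff_divide_distrib times_divide_eq_left)
  qed
  finally show ?thesis .
qed

section \<open>Symmetric equilibria in terms of the total day-ahead demand\<close>

text \<open>Here \<open>Dd\<close> is a free parameter; that it equals the sum of the resulting bids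
  is a separate consistency condition.\<close>

definition load_bid :: "real \<Rightarrow> 'l \<Rightarrow> real" where
  "load_bid Dd l = bd * d l / (bd + br * k) + bd / (1 + A) / (bd + br * k) * (D - Dd)
    - br / (bd + br * k) * Dd"

text \<open>Reduces equilibrium to a fixed-point problem in the single number \<open>Dd\<close>, on
  which every component of the outcome depends explicitly.\<close>

lemma symmetric_equilibrium_iff:
  fixes e :: "('g, 'l) outcome"
  defines "Dd \<equiv> sum (demand_da e) UNIV"
  shows "symmetric_equilibrium cost d bd br e \<longleftrightarrow>
    bid_da e = (\<lambda>_. bd * da_symmetric_price Dd - Dd / n) \<and>
    bid_rt e = (\<lambda>_. br * rt_response_price Dd - (D - Dd) / n) \<and>
    demand_da e = load_bid Dd \<and>
    price_da e = da_symmetric_price Dd \<and>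
    price_rt e = rt_response_price Dd" (is "_ \<longleftrightarrow> ?R")
proof -
  define \<beta>d dd where "\<beta>d = bid_da e" and "dd = demand_da e"
  have Dd: "Dd = sum dd UNIV" by (simp add: Dd_def dd_def)
  define p where "p = da_price bd \<beta>d dd"
  \<comment> \<open>Equal day-ahead bids give equal dispatches in both stages, and clearing then
    fixes each share.\<close>
  have gd: "da_dispatch \<beta>d dd j = Dd / n" and gr: "rt_response_dispatch \<beta>d dd j = (D - Dd) / n"
    if "\<forall>i. \<beta>d i = b" for b j
  proof -
    have *: "da_dispatch \<beta>d dd i = da_dispatch \<beta>d dd j" for i
      using that by (simp add: da_dispatch_def dispatch_def)
    then have "rt_response_dispatch \<beta>d dd = (\<lambda>_. rt_response_dispatch \<beta>d dd j)"
      by (simp add: fun_eq_iff rt_response_dispatch_def)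
    from arg_cong[OF this, of "\<lambda>f. sum f UNIV"]
    have "n * rt_response_dispatch \<beta>d dd j = D - Dd"
      by (simp add: sum_rt_response_dispatch n_def Dd)
    moreover have "da_dispatch \<beta>d dd = (\<lambda>_. da_dispatch \<beta>d dd j)"
      using * by blast
    from arg_cong[OF this, of "\<lambda>f. sum f UNIV"]
    have "n * da_dispatch \<beta>d dd j = Dd"
      by (simp add: sum_da_dispatch n_def Dd)
    ultimately show "da_dispatch \<beta>d dd j = Dd / n" "rt_response_dispatch \<beta>d dd j = (D - Dd) / n"
      using n_pos by (simp_all add: field_simps)
  qed
  show ?thesis
  proof
    assume "symmetric_equilibrium cost d bd br e"
    then obtain b where ts: "two_stage_equilibrium cost d bd br e" and b: "\<forall>j. \<beta>d j = b"
      unfolding symmetric_equilibrium_def \<beta>d_def by blast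
    note ts = ts[unfolded two_stage_equilibrium_iff, folded \<beta>d_def dd_def, folded Dd p_def,
        unfolded generator_da_foc load_da_foc, folded Dd p_def, unfolded gd[OF b] gr[OF b]
          symmetric_generator_foc[OF refl refl]]
    then have p: "p = da_symmetric_price Dd" by blast
    have "\<beta>d j = bd * p - Dd / n" for j
      using gd[OF b, of j] by (simp add: da_dispatch_def dispatch_def p_def)
    moreover have "bid_rt e j = br * rt_response_price Dd - (D - Dd) / n" for j
      using ts gr[OF b, of j] by (simp add: rt_response_def Dd)
    ultimately show ?R
      using ts[unfolded p load_foc_solved]
      by (auto simp: fun_eq_iff load_bid_def p \<beta>d_def dd_def)
  next
    assume R: ?R
    then have bid: "\<forall>j. \<beta>d j = bd * da_symmetric_price Dd - Dd / n"
      by (simp add: \<beta>d_def)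
    \<comment> \<open>The bids are read off from the candidate price, so it has to be checked that
      they clear the market at exactly that price.\<close>
    have "(\<Sum>j\<in>UNIV. dispatch bd (da_symmetric_price Dd) \<beta>d j) = Dd"
      using bid n_pos by (simp add: dispatch_def n_def[symmetric])
    then have p: "p = da_symmetric_price Dd"
      unfolding clearing_price_iff[OF bd_pos] by (simp add: p_def da_price_def Dd)
    have "bid_rt e = rt_response \<beta>d dd"
      using R by (auto simp: rt_response_def fun_eq_iff gr[OF bid] Dd[symmetric])
    moreover have "dd l = load_bid Dd l" for l
      using R by (simp add: dd_def)
    ultimately have "two_stage_equilibrium cost d bd br e"
      unfolding two_stage_equilibrium_iff \<beta>d_def[symmetric] dd_def[symmetric]
        generator_da_foc load_da_foc p_def[symmetric] Dd[symmetric] gd[OF bid] gr[OF bid]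
        symmetric_generator_foc[OF refl refl] p load_foc_solved
      using R by (simp add: load_bid_def)
    then show "symmetric_equilibrium cost d bd br e"
      using R by (simp add: symmetric_equilibrium_def)
  qed
qed

section \<open>Existence and uniqueness of the total day-ahead demand\<close>

text \<open>In equilibrium the total demand \<open>D\<close> splits between day-ahead and real time
  in the ratio \<open>da_weight\<close> to \<open>rt_weight\<close>.\<close>

definition da_weight :: real where "da_weight = bd * (m + 1 + A)"
definition rt_weight :: real where "rt_weight = br * (m + k) * (1 + A)"

lemma da_weight_pos: "da_weight > 0" and rt_weight_pos: "rt_weight > 0"
  using bd_pos br_pos m_pos k_pos A_pos by (simp_all add: da_weight_def rt_weight_def)

lemma sum_load_bid:
  "sum (load_bid Dd) UNIV = Dd \<longleftrightarrow> (D - Dd) * da_weight = Dd * rt_weight"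
proof -
  define E where "E = (D - Dd) / (1 + A)"
  have E: "D - Dd = E * (1 + A)" using A_pos by (simp add: E_def)
  have D: "D = E * (1 + A) + Dd" using E by simp
  have w: "bd + br * k > 0" using bd_pos br_pos k_pos by (simp add: add_pos_pos)
  have "load_bid Dd l = (bd * d l + (bd * E - br * Dd)) / (bd + br * k)" for l
  proof -
    have "bd / (1 + A) / (bd + br * k) * (D - Dd) = bd * E / (bd + br * k)"
      by (simp add: E_def)
    then show ?thesis
      by (simp add: load_bid_def add_divide_distrib diff_divide_distrib)
  qed
  then have S: "sum (load_bid Dd) UNIV = (bd * D + m * (bd * E - br * Dd)) / (bd + br * k)"
    by (simp add: sum_divide_distrib[symmetric] sum.distrib sum_distrib_left[symmetric] D_def m_def)
  have "sum (load_bid Dd) UNIV = Dd \<longleftrightarrow>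
      bd * D + m * (bd * E - br * Dd) = Dd * (bd + br * k)"
    unfolding S using w by (subst nonzero_divide_eq_eq) auto
  \<comment> \<open>Substituting \<open>D = E * (1 + A) + Dd\<close> cancels \<open>bd * Dd\<close>
    on both sides and separates \<open>E\<close> from \<open>Dd\<close>.\<close>
  also have "\<dots> \<longleftrightarrow> E * da_weight = Dd * (br * (m + k))"
    unfolding D da_weight_def by (auto simp: algebra_simps)
  also have "\<dots> \<longleftrightarrow> (E * da_weight) * (1 + A) = (Dd * (br * (m + k))) * (1 + A)"
    using A_pos by simp
  finally show ?thesis
    unfolding E rt_weight_def by (simp add: mult_ac)
qed

lemma weight_balance_iff:
  "(D - Dd) * da_weight = Dd * rt_weight \<longleftrightarrow> Dd = D * da_weight / (da_weight + rt_weight)"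
  using da_weight_pos rt_weight_pos by (auto simp: field_simps)

lemma symmetric_equilibrium_ex1: "\<exists>!e :: ('g, 'l) outcome. symmetric_equilibrium cost d bd br e"
proof -
  define Dd where "Dd = D * da_weight / (da_weight + rt_weight)"
  define e :: "('g, 'l) outcome" where
    "e = \<lparr>bid_da = (\<lambda>_. bd * da_symmetric_price Dd - Dd / n),
      bid_rt = (\<lambda>_. br * rt_response_price Dd - (D - Dd) / n),
      demand_da = load_bid Dd, price_da = da_symmetric_price Dd, price_rt = rt_response_price Dd\<rparr>"
  have "sum (load_bid Dd) UNIV = Dd"
    unfolding sum_load_bid weight_balance_iff Dd_def ..
  then have "symmetric_equilibrium cost d bd br e"
    by (simp add: symmetric_equilibrium_iff e_def)
  moreover have "e' = e" if "symmetric_equilibrium cost d bd br e'" for e'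
  proof -
    note R = that[unfolded symmetric_equilibrium_iff]
    \<comment> \<open>Summing the loads' component of the characterisation yields the fixed-point
      equation, which has only the solution \<open>Dd\<close>.\<close>
    then have "sum (load_bid (sum (demand_da e') UNIV)) UNIV = sum (demand_da e') UNIV"
      by metis
    then have "sum (demand_da e') UNIV = Dd"
      unfolding sum_load_bid weight_balance_iff Dd_def .
    then show ?thesis using R by (simp add: e_def)
  qed
  ultimately show ?thesis by blast
qed

section \<open>Closed forms of bids and prices\<close>

lemma bid_da_closed:
  assumes "(D - Dd) * da_weight = Dd * rt_weight"
  shows "bd * da_symmetric_price Dd - Dd / n
    = bd * c / n * D + (br * c - (n - 2) / (n - 1)) / (br * c + (m + 1) / (n - 1))
        * ((m + 1) / (n * (n - 1))) * Dd"
proof -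
  have a: "m + 1 + A > 0" using A_pos m_pos by simp
  \<comment> \<open>The balance of the two weights trades the real-time demand \<open>D - Dd\<close>
    for a multiple of \<open>Dd\<close>.\<close>
  have Dr: "bd * c * (D - Dd) / (n * (1 + A)) = br * c * (m + k) * Dd / (n * (m + 1 + A))"
  proof -
    have "bd * (D - Dd) / (1 + A) = br * (m + k) * Dd / (m + 1 + A)"
      using assms A_pos a by (simp add: da_weight_def rt_weight_def divide_simps mult_ac)
    then have "(c / n) * (bd * (D - Dd) / (1 + A)) = (c / n) * (br * (m + k) * Dd / (m + 1 + A))"
      by simp
    then show ?thesis by (simp add: mult_ac)
  qed
  have num: "br * c - (n - 2) / k = (A - (k - 1)) / k" and den: "br * c + (m + 1) / k = (m + 1 + A) / k"
    using k_pos by (simp_all add: A_def n_eq field_simps)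
  have "bd * da_symmetric_price Dd - Dd / n
      = bd * c / n * D + br * c * (m + k) * Dd / (n * (m + 1 + A)) + Dd / (n * k) - Dd / n"
    unfolding da_symmetric_price_def using bd_pos Dr by (simp add: algebra_simps)
  also have "\<dots> = bd * c / n * D + (A * (m + k) + (1 - k) * (m + 1 + A)) / (n * k * (m + 1 + A)) * Dd"
    using n_pos k_pos a by (simp add: A_def divide_simps) (simp add: algebra_simps)
  also have "A * (m + k) + (1 - k) * (m + 1 + A) = (A - (k - 1)) * (m + 1)"
    by (simp add: algebra_simps)
  also have "bd * c / n * D + (A - (k - 1)) * (m + 1) / (n * k * (m + 1 + A)) * Dd
      = bd * c / n * D + (br * c - (n - 2) / k) / (br * c + (m + 1) / k) * ((m + 1) / (n * k)) * Dd"
    unfolding num den using k_pos a n_pos by simp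
  finally show ?thesis by (simp add: k_def)
qed

lemma bid_rt_closed:
  "br * rt_response_price Dd - (D - Dd) / n
    = br * c / n * D - (n - 2) / (n * (n - 1)) * (D - Dd)"
proof -
  have "br * rt_response_price Dd - (D - Dd) / n
      = br * c / n * D + (1 / (n * k) - 1 / n) * (D - Dd)"
  proof -
    have "br * ((D - Dd) / (n * br * k)) = 1 / (n * k) * (D - Dd)"
      using br_pos by simp
    then show ?thesis
      by (simp only: rt_response_price_def distrib_left left_diff_distrib) (simp add: mult_ac)
  qed
  \<comment> \<open>Uses \<open>k - 1 = n - 2\<close>.\<close>
  also have "1 / (n * k) - 1 / n = - ((n - 2) / (n * k))"
    using n_pos k_pos by (simp add: divide_simps) (simp add: n_eq algebra_simps)
  finally show ?thesis by (simp add: k_def)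
qed

lemma price_da_closed:
  "da_symmetric_price Dd
    = (br * c * (n - 1) + 2) / (br * c * (n - 1) + 1) * (c / n) * D
      + ((br / bd - 1) * c + 1 / (bd * (n - 1))) / (br * c * (n - 1) + 1) * (Dd / n)"
proof -
  have A: "br * c * (n - 1) = A" by (simp add: A_def k_def)
  have "(br / bd - 1) * c + 1 / (bd * k) = (1 + A) / (bd * k) - c"
    using bd_pos k_pos by (simp add: A_def field_simps)
  moreover have "(A + 2) / (A + 1) = 1 + 1 / (1 + A)"
    using A_pos by (simp add: field_simps)
  ultimately have "(A + 2) / (A + 1) * (c / n) * D
      + ((br / bd - 1) * c + 1 / (bd * k)) / (A + 1) * (Dd / n)
    = (1 + 1 / (1 + A)) * (c / n) * D + ((1 + A) / (bd * k) - c) / (1 + A) * (Dd / n)"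
    by (simp add: add.commute)
  also have "\<dots> = da_symmetric_price Dd"
  proof -
    define r where "r = 1 / (1 + A)"
    have margin: "((1 + A) / (bd * k) - c) / (1 + A) = 1 / (bd * k) - c * r"
      using A_pos by (simp add: r_def diff_divide_distrib)
    have "c * (D - Dd) / (n * (1 + A)) = r * (c * D / n - c * Dd / n)"
      by (simp add: r_def diff_divide_distrib right_diff_distrib mult.commute)
    then show ?thesis
      unfolding margin da_symmetric_price_def by (simp add: r_def[symmetric] algebra_simps add_divide_distrib)
  qed
  finally show ?thesis by (simp add: A k_def)
qed

lemma price_rt_closed:
  assumes "(D - Dd) * da_weight = Dd * rt_weight"
  shows "rt_response_price Dd = da_symmetric_price Dd
    + (1 / (n * (n - 1)) * ((n - 2) / (n - 1) - br * c) * D)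
      / (bd * (br * c + (m + 1) / (n - 1)) + br * (br * c + 1 / (n - 1)) * (n + m - 1))"
proof -
  \<comment> \<open>With the common scale \<open>t\<close>, the day-ahead and real-time demands
    become \<open>t * da_weight\<close> and \<open>t * rt_weight\<close>, so the price gap is a
    multiple of \<open>t\<close> and hence of \<open>D\<close>.\<close>
  define t where "t = D / (da_weight + rt_weight)"
  have Dd: "Dd = t * da_weight"
    using assms by (simp add: weight_balance_iff t_def)
  have D: "D = t * (da_weight + rt_weight)"
    using da_weight_pos rt_weight_pos by (simp add: t_def)
  have Dr: "D - Dd = t * rt_weight"
    by (simp add: D Dd algebra_simps)
  have den: "bd * (br * c + (m + 1) / k) + br * (br * c + 1 / k) * (n + m - 1)
      = (da_weight + rt_weight) / k"
    using k_pos by (simp add: da_weight_def rt_weight_def A_def n_eq field_simps)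
  have num: "(n - 2) / k - br * c = (k - 1 - A) / k"
    using k_pos by (simp add: A_def n_eq field_simps)
  have "rt_response_price Dd - da_symmetric_price Dd
      = (D - Dd) / (n * br * k) - c * (D - Dd) / (n * (1 + A)) - Dd / (n * bd * k)"
    by (simp add: rt_response_price_def da_symmetric_price_def)
  also have "\<dots> = t * ((m + k) * (1 + A) - (m + k) * A - (m + 1 + A)) / (n * k)"
  proof -
    have "t * rt_weight / (n * br * k) = t * ((m + k) * (1 + A)) / (n * k)"
      using br_pos by (simp add: rt_weight_def)
    moreover have "c * (t * rt_weight) / (n * (1 + A)) = t * ((m + k) * (br * c)) / n"
      using A_pos by (simp add: rt_weight_def)
    moreover have "br * c = A / k"
      using k_pos by (simp add: A_def)
    moreover have "t * da_weight / (n * bd * k) = t * (m + 1 + A) / (n * k)"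
      using bd_pos by (simp add: da_weight_def)
    ultimately show ?thesis
      unfolding Dr unfolding Dd by (simp add: diff_divide_distrib right_diff_distrib mult.commute)
  qed
  \<comment> \<open>The number of loads cancels from the numerator.\<close>
  also have "\<dots> = t * (k - 1 - A) / (n * k)"
    by (simp add: algebra_simps)
  also have "\<dots> = (1 / (n * k) * ((k - 1 - A) / k) * D) / ((da_weight + rt_weight) / k)"
    using k_pos n_pos by (simp add: t_def mult_ac)
  finally show ?thesis
    unfolding k_def[symmetric] den num by linarith
qed

text \<open>Both sides contain the loads' condition. If it fails, both are false; if it holds,
  summing it gives the balance under which the closed forms agree with the earlier
  expressions.\<close>

lemma symmetric_equilibrium_closed:
  fixes e :: "('g, 'l) outcome"
  defines "Dd \<equiv> sum (demand_da e) UNIV"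
  shows "symmetric_equilibrium cost d bd br e \<longleftrightarrow>
    (\<forall>j. bid_da e j =
      bd * c / n * D + (br * c - (n - 2) / (n - 1)) / (br * c + (m + 1) / (n - 1))
        * ((m + 1) / (n * (n - 1))) * Dd) \<and>
    (\<forall>j. bid_rt e j = br * c / n * D - (n - 2) / (n * (n - 1)) * (D - Dd)) \<and>
    (\<forall>j. gen_da bd e j = 1 / n * Dd) \<and>
    (\<forall>j. gen_rt br e j = 1 / n * (D - Dd)) \<and>
    (\<forall>l. demand_da e l =
      bd * d l / (bd + br * (n - 1))
      + (bd / (1 + br * c * (n - 1))) / (bd + br * (n - 1)) * (D - Dd)
      - br / (bd + br * (n - 1)) * Dd) \<and>
    price_da e =
      (br * c * (n - 1) + 2) / (br * c * (n - 1) + 1) * (c / n) * D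
      + ((br / bd - 1) * c + 1 / (bd * (n - 1))) / (br * c * (n - 1) + 1) * (Dd / n) \<and>
    price_rt e = price_da e
      + (1 / (n * (n - 1)) * ((n - 2) / (n - 1) - br * c) * D)
        / (bd * (br * c + (m + 1) / (n - 1)) + br * (br * c + 1 / (n - 1)) * (n + m - 1))"
    (is "_ \<longleftrightarrow> ?bd \<and> ?br \<and> ?gd \<and> ?gr \<and> ?l \<and> ?pd \<and> ?pr")
proof -
  have l: "?l \<longleftrightarrow> demand_da e = load_bid Dd"
    by (simp add: fun_eq_iff load_bid_def A_def k_def)
  show ?thesis
  proof (cases "demand_da e = load_bid Dd")
    case True
    then have bal: "(D - Dd) * da_weight = Dd * rt_weight"
      unfolding sum_load_bid[symmetric] Dd_def by metis
    show ?thesis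
      unfolding l symmetric_equilibrium_iff Dd_def[symmetric]
      unfolding bid_da_closed[OF bal, symmetric] bid_rt_closed[symmetric] price_da_closed[symmetric]
      using price_rt_closed[OF bal]
      by (auto simp: fun_eq_iff True gen_da_def gen_rt_def dispatch_def)
  next
    case False
    then show ?thesis
      unfolding l symmetric_equilibrium_iff Dd_def[symmetric] by blast
  qed
qed

end

theorem theorem3:
  fixes cost :: "'g::finite \<Rightarrow> real" and d :: "'l::finite \<Rightarrow> real" and c bd br :: real
  assumes "\<forall>j. cost j > 0" and "\<forall>l. d l > 0" and "bd > 0" and "br > 0"
    and homogeneous: "\<forall>j. cost j = c"
    and "CARD('g) > 1"
  shows "(\<exists>!e :: ('g, 'l) outcome. symmetric_equilibrium cost d bd br e) \<and>
    (\<forall>e :: ('g, 'l) outcome. symmetric_equilibrium cost d bd br e \<longleftrightarrow>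
      (let n = real CARD('g); m = real CARD('l);
           D = (\<Sum>l\<in>UNIV. d l);
           Dd = (\<Sum>l\<in>UNIV. demand_da e l);
           Dr = (\<Sum>l\<in>UNIV. demand_rt d e l)
       in
        (\<forall>j. bid_da e j =
              bd * c / n * D
              + (br * c - (n - 2) / (n - 1)) / (br * c + (m + 1) / (n - 1))
                * ((m + 1) / (n * (n - 1))) * Dd) \<and>
        (\<forall>j. bid_rt e j = br * c / n * D - (n - 2) / (n * (n - 1)) * Dr) \<and>
        (\<forall>j. gen_da bd e j = 1 / n * Dd) \<and>
        (\<forall>j. gen_rt br e j = 1 / n * Dr) \<and>
        (\<forall>l. demand_da e l =
              bd * d l / (bd + br * (n - 1))
              + (bd / (1 + br * c * (n - 1))) / (bd + br * (n - 1)) * Dr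
              - br / (bd + br * (n - 1)) * Dd) \<and>
        (\<forall>l. demand_rt d e l = d l - demand_da e l) \<and>
        price_da e =
          (br * c * (n - 1) + 2) / (br * c * (n - 1) + 1) * (c / n) * D
          + ((br / bd - 1) * c + 1 / (bd * (n - 1))) / (br * c * (n - 1) + 1) * (Dd / n) \<and>
        price_rt e =
          price_da e
          + (1 / (n * (n - 1)) * ((n - 2) / (n - 1) - br * c) * D)
            / (bd * (br * c + (m + 1) / (n - 1))
               + br * (br * c + 1 / (n - 1)) * (n + m - 1))))"
proof -
  interpret homogeneous_market cost d c bd br
    using assms by unfold_locales auto
  have Dr: "(\<Sum>l\<in>UNIV. demand_rt d e l) = D - sum (demand_da e) UNIV" for e :: "('g, 'l) outcome"
    by (simp add: demand_rt_def rt_demand)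
  show ?thesis
    unfolding Let_def Dr n_def[symmetric] m_def[symmetric] D_def[symmetric]
    using symmetric_equilibrium_ex1 symmetric_equilibrium_closed by (simp add: demand_rt_def)
qed

end
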